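(* Assume that $\sum_{s\in\mathcal S}p_s\omega_s^0=0$ holds for the initial multipliers of the FW-PH algorithm (described in the context). At each iteration $k\ge1$ of the FW-PH algorithm, the value $\phi^k=\sum_{s\in\mathcal S}p_s\phi_s^k$ computed by the algorithm is the value of the Lagrangian dual function $\phi(\cdot)$ evaluated at a Lagrangian dual feasible point, i.e. $\phi^k=\phi(\widetilde\omega)$ for some $\widetilde\omega=(\widetilde\omega_s)_{s\in\mathcal S}$ with $\sum_{s\in\mathcal S}p_s\widetilde\omega_s=0$; hence $\phi^k$ is a finite lower bound on $\zeta^{LD}$.
   Context: Setting. $\mathcal S$ is a finite set of scenarios with probabilities $p_s>0$, $\sum_{s\in\mathcal S}p_s=1$. Let $c\in\mathbb{R}^{n_x}$ and $q_s\in\mathbb{R}^{n_y}$. Let $X\subset\mathbb{R}^{n_x}$ and $Y_s\subset\mathbb{R}^{n_y}$ be mixed-integer linear sets (finitely many linear constraints plus integrality restrictions on some components), and let $K_s=\{(x,y): W_sy=h_s-T_sx,\ x\in X,\ y\in Y_s\}$ for given matrices $W_s,T_s$ and vectors $h_s$. Standing assumption: each $K_s$ is nonempty and each $\mathrm{conv}(K_s)$ is bounded (so it is a polytope). $\mathcal V(\mathrm{conv}(K_s))$ denotes its set of extreme points. Lagrangian dual. For $\omega=(\omega_s)_{s\in\mathcal S}$ with $\omega_s\in\mathbb{R}^{n_x}$ and $\sum_sp_s\omega_s=0$ (dual feasibility), $$\phi(\omega)=\sum_{s\in\mathcal S}p_s\phi_s(\omega_s),\qquad \phi_s(\omega_s)=\min_{x,y}\{(c+\omega_s)^\top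 x+q_s^\top y:(x,y)\in K_s\},$$ and $\zeta^{LD}=\sup_\omega\{\phi(\omega):\sum_{s\in\mathcal S}p_s\omega_s=0\}$. For $\rho>0$, $L_s^\rho(x,y,z,\omega_s)=c^\top x+q_s^\top y+\omega_s^\top(x-z)+\tfrac{\rho}{2}\|x-z\|_2^2$. Procedure SDM$(V_s^0,x_s^0,\omega_s,z,t_{max},\tau)$ for scenario $s$ (its inputs $V_s^0, x_s^0$ are local names), with finite $V_s^0\subset\mathrm{conv}(K_s)$. For $t=1,\dots,t_{max}$: (i) $\widehat\omega_s^t\gets\omega_s+\rho(x_s^{t-1}-z)$; (ii) choose $(\widehat x_s,\widehat y_s)\in\arg\min\{(c+\widehat\omega_s^t)^\top x+q_s^\top y:(x,y)\in\mathcal V(\mathrm{conv}(K_s))\}$; (iii) if $t=1$, set $\phi_s\gets(c+\widehat\omega_s^1)^\top\widehat x_s+q_s^\top\widehat y_s$; (iv) $\Gamma^t\gets-[(c+\widehat\omega_s^t)^\top(\widehat x_s-x_s^{t-1})+q_s^\top(\widehat y_s-y_s^{t-1})]$; (v) $V_s^t\gets V_s^{t-1}\cup\{(\widehat x_s,\widehat y_s)\}$; (vi) choose $(x_s^t,y_s^t)\in\arg\min\{L_s^\rho(x,y,z,\omega_s):(x,y)\in\mathrm{conv}(V_s^t)\}$; (vii) if $\Gamma^t\le\tau$, return $(x_s^t,y_s^t,V_s^t,\phi_s)$. If the loop ends, return $(x_s^{t_{max}},y_s^{t_{max}},V_s^{t_{max}},\phi_s)$. FW-PH algorithm. Inputs: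 finite sets $V_s^0\subset\mathrm{conv}(K_s)$, points $(x_s^0,y_s^0)_{s\in\mathcal S}$, multipliers $\omega^0=(\omega_s^0)_{s\in\mathcal S}$ with $\omega_s^0\in\mathbb{R}^{n_x}$, and parameters $\rho>0$, $\alpha\in\mathbb{R}$, $\epsilon\ge0$, $k_{max}\ge1$, $t_{max}\ge1$. Set $z^0\gets\sum_sp_sx_s^0$ and $\omega_s^1\gets\omega_s^0+\rho(x_s^0-z^0)$. For $k=1,2,\dots,k_{max}$: for each $s\in\mathcal S$, set $\widetilde x_s\gets(1-\alpha)z^{k-1}+\alpha x_s^{k-1}$ and $[x_s^k,y_s^k,V_s^k,\phi_s^k]\gets\mathrm{SDM}(V_s^{k-1},\widetilde x_s,\omega_s^k,z^{k-1},t_{max},0)$ (in step (iv) with $t=1$, the $y$-component of the starting point is $y_s^{k-1}$); then $\phi^k\gets\sum_sp_s\phi_s^k$ and $z^k\gets\sum_sp_sx_s^k$; stop if $\sqrt{\sum_sp_s\|x_s^k-z^{k-1}\|_2^2}<\epsilon$; otherwise $\omega_s^{k+1}\gets\omega_s^k+\rho(x_s^k-z^k)$ for all $s$. *)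

theory Defs
  imports "HOL-Analysis.Analysis"
begin

definition mixed_integer_linear_set :: "(real ^ 'n) set \<Rightarrow> bool" where
  "mixed_integer_linear_set A \<longleftrightarrow>
     (\<exists>(C :: ((real ^ 'n) \<times> real) set) (I :: 'n set). finite C \<and>
        A = {v. (\<forall>(a, b)\<in>C. a \<bullet> v \<le> b) \<and> (\<forall>i\<in>I. v $ i \<in> \<int>)})"

text \<open>The number \<open>m\<close> of equations may differ between scenarios, so the matrices \<open>T\<close> and \<open>W\<close>
  are given by their rows \<open>T i\<close> and \<open>W i\<close> for \<open>i < m\<close>.\<close>

definition scenario_set ::
  "(real ^ 'nx) set \<Rightarrow> (real ^ 'ny) set \<Rightarrow> nat \<Rightarrow> (nat \<Rightarrow> real ^ 'nx) \<Rightarrow> (nat \<Rightarrow> real ^ 'ny) \<Rightarrow>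
   (nat \<Rightarrow> real) \<Rightarrow> ((real ^ 'nx) \<times> (real ^ 'ny)) set" where
  "scenario_set X Y m T W h =
     {(x, y). x \<in> X \<and> y \<in> Y \<and> (\<forall>i<m. W i \<bullet> y = h i - T i \<bullet> x)}"

text \<open>The dual function and its supremum are extended reals: finiteness of the minima is then
  not presupposed, and the supremum may well be \<open>\<infinity>\<close>.
  The infimum is the minimum whenever the latter exists.\<close>

definition scenario_dual ::
  "real ^ 'nx \<Rightarrow> real ^ 'ny \<Rightarrow> ((real ^ 'nx) \<times> (real ^ 'ny)) set \<Rightarrow> real ^ 'nx \<Rightarrow> ereal" where
  "scenario_dual c q K \<omega> = (INF (x, y)\<in>K. ereal ((c + \<omega>) \<bullet> x + q \<bullet> y))"

definition lagrangian_dual ::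
  "'s set \<Rightarrow> ('s \<Rightarrow> real) \<Rightarrow> real ^ 'nx \<Rightarrow> ('s \<Rightarrow> real ^ 'ny) \<Rightarrow>
   ('s \<Rightarrow> ((real ^ 'nx) \<times> (real ^ 'ny)) set) \<Rightarrow> ('s \<Rightarrow> real ^ 'nx) \<Rightarrow> ereal" where
  "lagrangian_dual S p c q K \<omega> =
     (\<Sum>s\<in>S. ereal (p s) * scenario_dual c (q s) (K s) (\<omega> s))"

definition dual_feasible ::
  "'s set \<Rightarrow> ('s \<Rightarrow> real) \<Rightarrow> ('s \<Rightarrow> real ^ 'nx) \<Rightarrow> bool" where
  "dual_feasible S p \<omega> \<longleftrightarrow> (\<Sum>s\<in>S. p s *\<^sub>R \<omega> s) = 0"

definition zeta_LD ::
  "'s set \<Rightarrow> ('s \<Rightarrow> real) \<Rightarrow> real ^ 'nx \<Rightarrow> ('s \<Rightarrow> real ^ 'ny) \<Rightarrow>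
   ('s \<Rightarrow> ((real ^ 'nx) \<times> (real ^ 'ny)) set) \<Rightarrow> ereal" where
  "zeta_LD S p c q K = (SUP \<omega>\<in>{\<omega>. dual_feasible S p \<omega>}. lagrangian_dual S p c q K \<omega>)"

definition aug_lagrangian ::
  "real \<Rightarrow> real ^ 'nx \<Rightarrow> real ^ 'ny \<Rightarrow> real ^ 'nx \<Rightarrow> real ^ 'ny \<Rightarrow> real ^ 'nx \<Rightarrow> real ^ 'nx \<Rightarrow> real"
  where
  "aug_lagrangian \<rho> c q x y z \<omega> =
     c \<bullet> x + q \<bullet> y + \<omega> \<bullet> (x - z) + \<rho> / 2 * (norm (x - z))\<^sup>2"

text \<open>Since the minimisers are chosen arbitrarily, both procedures are relations between inputs
  and possible executions. In \<open>sdm\<close>, \<open>N\<close> is the number of passes through the loop;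
  the last four arguments are the returned values.\<close>

definition sdm ::
  "real \<Rightarrow> real ^ 'nx \<Rightarrow> real ^ 'ny \<Rightarrow> ((real ^ 'nx) \<times> (real ^ 'ny)) set \<Rightarrow>
   ((real ^ 'nx) \<times> (real ^ 'ny)) set \<Rightarrow> real ^ 'nx \<Rightarrow> real ^ 'ny \<Rightarrow> real ^ 'nx \<Rightarrow> real ^ 'nx \<Rightarrow>
   nat \<Rightarrow> real \<Rightarrow>
   real ^ 'nx \<Rightarrow> real ^ 'ny \<Rightarrow> ((real ^ 'nx) \<times> (real ^ 'ny)) set \<Rightarrow> real \<Rightarrow> bool" where
  "sdm \<rho> c q K V0 x0 y0 \<omega> z tmax \<tau> x' y' V' \<phi>' \<longleftrightarrow>
     (\<exists>N x y V \<omega>h xh yh \<Gamma>.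
        1 \<le> N \<and> N \<le> tmax \<and> x 0 = x0 \<and> y 0 = y0 \<and> V 0 = V0 \<and>
        (\<forall>t\<in>{1..N}.
           \<omega>h t = \<omega> + \<rho> *\<^sub>R (x (t - 1) - z) \<and>
           is_arg_min (\<lambda>(a, b). (c + \<omega>h t) \<bullet> a + q \<bullet> b)
             (\<lambda>v. v extreme_point_of (convex hull K)) (xh t, yh t) \<and>
           \<Gamma> t = - ((c + \<omega>h t) \<bullet> (xh t - x (t - 1)) + q \<bullet> (yh t - y (t - 1))) \<and>
           V t = V (t - 1) \<union> {(xh t, yh t)} \<and>
           is_arg_min (\<lambda>(a, b). aug_lagrangian \<rho> c q a b z \<omega>)
             (\<lambda>v. v \<in> convex hull (V t)) (x t, y t)) \<and>
        (\<forall>t\<in>{1..<N}. \<not> \<Gamma> t \<le> \<tau>) \<and> (\<Gamma> N \<le> \<tau> \<or> N = tmax) \<and>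
        x' = x N \<and> y' = y N \<and> V' = V N \<and> \<phi>' = (c + \<omega>h 1) \<bullet> xh 1 + q \<bullet> yh 1)"

text \<open>\<open>N\<close> is the number of iterations performed before the algorithm halts. Superscripts become
  the first argument of the iterates, index \<open>0\<close> being the input (respectively \<open>z\<^sup>0\<close>);
  values at indices not reached are unconstrained.\<close>

definition fwph_run ::
  "'s set \<Rightarrow> ('s \<Rightarrow> real) \<Rightarrow> real ^ 'nx \<Rightarrow> ('s \<Rightarrow> real ^ 'ny) \<Rightarrow>
   ('s \<Rightarrow> ((real ^ 'nx) \<times> (real ^ 'ny)) set) \<Rightarrow>
   real \<Rightarrow> real \<Rightarrow> real \<Rightarrow> nat \<Rightarrow> nat \<Rightarrow> nat \<Rightarrow>
   (nat \<Rightarrow> 's \<Rightarrow> real ^ 'nx) \<Rightarrow> (nat \<Rightarrow> 's \<Rightarrow> real ^ 'ny) \<Rightarrow>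
   (nat \<Rightarrow> 's \<Rightarrow> ((real ^ 'nx) \<times> (real ^ 'ny)) set) \<Rightarrow>
   (nat \<Rightarrow> 's \<Rightarrow> real ^ 'nx) \<Rightarrow> (nat \<Rightarrow> real ^ 'nx) \<Rightarrow>
   (nat \<Rightarrow> 's \<Rightarrow> real) \<Rightarrow> (nat \<Rightarrow> real) \<Rightarrow> bool" where
  "fwph_run S p c q K \<rho> \<alpha> \<epsilon> kmax tmax N x y V \<omega> z \<phi>s \<phi> \<longleftrightarrow>
     (let stop = (\<lambda>k. sqrt (\<Sum>s\<in>S. p s * (norm (x k s - z (k - 1)))\<^sup>2) < \<epsilon>) in
        1 \<le> N \<and> N \<le> kmax \<and>
        z 0 = (\<Sum>s\<in>S. p s *\<^sub>R x 0 s) \<and>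
        (\<forall>s\<in>S. \<omega> 1 s = \<omega> 0 s + \<rho> *\<^sub>R (x 0 s - z 0)) \<and>
        (\<forall>k\<in>{1..N}.
           (\<forall>s\<in>S. sdm \<rho> c (q s) (K s)
              (V (k - 1) s) ((1 - \<alpha>) *\<^sub>R z (k - 1) + \<alpha> *\<^sub>R x (k - 1) s) (y (k - 1) s)
              (\<omega> k s) (z (k - 1)) tmax 0
              (x k s) (y k s) (V k s) (\<phi>s k s)) \<and>
           \<phi> k = (\<Sum>s\<in>S. p s * \<phi>s k s) \<and>
           z k = (\<Sum>s\<in>S. p s *\<^sub>R x k s) \<and>
           (\<not> stop k \<longrightarrow> (\<forall>s\<in>S. \<omega> (k + 1) s = \<omega> k s + \<rho> *\<^sub>R (x k s - z k)))) \<and>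
        (\<forall>k\<in>{1..<N}. \<not> stop k) \<and> (stop N \<or> N = kmax))"

end

theory Submission
  imports Defs
begin

text \<open>Two observations carry the proof.

  The value \<open>\<phi>\<^sub>s\<close> is set in the first pass of the inner loop, where the linear objective has
  the multiplier \<open>\<omega>\<^sub>s + \<rho> (\<widetilde>x\<^sub>s - z)\<close> in place of \<open>\<omega>\<^sub>s\<close>. The set \<open>K\<^sub>s\<close> is
  closed (affine constraints and integrality conditions are closed) and bounded, so by Minkowski's
  theorem \<open>conv K\<^sub>s\<close> is the convex hull of its extreme points, all of which lie in \<open>K\<^sub>s\<close>. A linear
  function therefore has the same minimum over these extreme points as over \<open>K\<^sub>s\<close>, and \<open>\<phi>\<^sub>s\<close> is
  the value of the scenario dual function at that multiplier (\<open>sdm_value_eq_scenario_dual\<close>).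

  The shifted multipliers are dual feasible. Since \<open>z\<close> is the weighted mean of the \<open>x\<^sub>s\<close>, adding a
  multiple of \<open>x\<^sub>s - z\<close> to each \<open>\<omega>\<^sub>s\<close> leaves \<open>\<Sum> p\<^sub>s \<omega>\<^sub>s\<close> unchanged
  (\<open>dual_feasible_add_deviation\<close>). Every multiplier update has this form, and so has the shift,
  because \<open>\<widetilde>x\<^sub>s - z = \<alpha> (x\<^sub>s - z)\<close>: this is where the starting point of the inner loop being
  a combination of \<open>x\<^sub>s\<close> and \<open>z\<close> matters.\<close>

lemma closed_mixed_integer_linear_set:
  fixes A :: "(real ^ 'n) set"
  assumes "mixed_integer_linear_set A"
  shows "closed A"
proof -
  obtain C and I :: "'n set" where
    A: "A = {v. (\<forall>(a, b)\<in>C. a \<bullet> v \<le> b) \<and> (\<forall>i\<in>I. v $ i \<in> \<int>)}"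
    using assms unfolding mixed_integer_linear_set_def by blast
  have "A = (\<Inter>(a, b)\<in>C. {v. a \<bullet> v \<le> b}) \<inter> (\<Inter>i\<in>I. (\<lambda>v. v $ i) -` \<int>)"
    unfolding A by auto
  moreover have "closed ((\<lambda>v :: real ^ 'n. v $ i) -` \<int>)" for i
    by (intro closed_vimage closed_Ints continuous_intros)
  ultimately show ?thesis
    by (auto intro!: closed_Int closed_INT closed_halfspace_le)
qed

lemma closed_scenario_set:
  fixes X :: "(real ^ 'nx) set" and Y :: "(real ^ 'ny) set"
  assumes "closed X" "closed Y"
  shows "closed (scenario_set X Y m T W h)"
proof -
  have "scenario_set X Y m T W h =
      (X \<times> Y) \<inter> (\<Inter>i\<in>{..<m}. {v. W i \<bullet> snd v = h i - T i \<bullet> fst v})"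
    unfolding scenario_set_def by auto
  moreover have "closed {v :: (real ^ 'nx) \<times> (real ^ 'ny). W i \<bullet> snd v = h i - T i \<bullet> fst v}" for i
    by (intro closed_Collect_eq continuous_intros)
  ultimately show ?thesis
    using assms by (auto intro!: closed_Int closed_INT closed_Times)
qed

text \<open>By Minkowski's theorem the extreme points generate the whole hull, and the half-space on
  which the objective is at least its minimum over the extreme points is convex.\<close>

lemma extreme_point_minimiser_is_minimiser:
  fixes K :: "'a::euclidean_space set"
  assumes "compact K"
    and min: "is_arg_min (\<lambda>u. g \<bullet> u) (\<lambda>u. u extreme_point_of (convex hull K)) v"
  shows "v \<in> K" and "\<And>u. u \<in> K \<Longrightarrow> g \<bullet> v \<le> g \<bullet> u"
proof -
  show "v \<in> K"
    using min extreme_point_of_convex_hull unfolding is_arg_min_def by blast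
next
  fix u assume "u \<in> K"
  have hull: "convex hull K = convex hull {w. w extreme_point_of (convex hull K)}"
    using assms(1) by (intro Krein_Milman_Minkowski compact_convex_hull convex_convex_hull)
  have "{w. w extreme_point_of (convex hull K)} \<subseteq> {w. g \<bullet> w \<ge> g \<bullet> v}"
    using min unfolding is_arg_min_linorder by auto
  then have "convex hull K \<subseteq> {w. g \<bullet> w \<ge> g \<bullet> v}"
    by (subst hull) (intro hull_minimal convex_halfspace_ge)
  then show "g \<bullet> v \<le> g \<bullet> u"
    using \<open>u \<in> K\<close> hull_subset[of K convex] by blast
qed

lemma sdm_value_eq_scenario_dual:
  fixes K :: "((real ^ 'nx) \<times> (real ^ 'ny)) set"
  assumes "compact K" and "sdm \<rho> c q K V0 x0 y0 \<omega> z tmax \<tau> x' y' V' \<phi>'"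
  shows "ereal \<phi>' = scenario_dual c q K (\<omega> + \<rho> *\<^sub>R (x0 - z))"
proof -
  obtain \<omega>h xh yh where \<omega>h: "\<omega>h = \<omega> + \<rho> *\<^sub>R (x0 - z)"
    and min: "is_arg_min (\<lambda>(a, b). (c + \<omega>h) \<bullet> a + q \<bullet> b)
        (\<lambda>v. v extreme_point_of (convex hull K)) (xh, yh)"
    and \<phi>': "\<phi>' = (c + \<omega>h) \<bullet> xh + q \<bullet> yh"
  proof -
    from assms(2) obtain N x \<omega>h xh yh where "1 \<le> (N::nat)" "x 0 = x0"
      and loop: "\<forall>t\<in>{1..N}. \<omega>h t = \<omega> + \<rho> *\<^sub>R (x (t - 1) - z) \<and>
          is_arg_min (\<lambda>(a, b). (c + \<omega>h t) \<bullet> a + q \<bullet> b)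
            (\<lambda>v. v extreme_point_of (convex hull K)) (xh t, yh t)"
      and "\<phi>' = (c + \<omega>h 1) \<bullet> xh 1 + q \<bullet> yh 1"
      unfolding sdm_def by blast
    then show thesis
      using bspec[OF loop, of 1] by (intro that[of "\<omega>h 1" "xh 1" "yh 1"]) auto
  qed
  define g where "g = (c + \<omega>h, q)"
  have g: "(\<lambda>(a, b). (c + \<omega>h) \<bullet> a + q \<bullet> b) = (\<lambda>u. g \<bullet> u)"
    by (auto simp: g_def inner_Pair)
  note opt = extreme_point_minimiser_is_minimiser[OF assms(1) min[unfolded g]]
  have "scenario_dual c q K \<omega>h = (INF u\<in>K. ereal (g \<bullet> u))"
    unfolding scenario_dual_def g_def by (simp add: case_prod_beta inner_prod_def)
  also have "\<dots> = ereal (g \<bullet> (xh, yh))"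
    by (rule INF_eqI) (use opt in auto)
  finally show ?thesis
    by (simp add: g_def inner_Pair \<phi>' \<omega>h)
qed

lemma dual_feasible_add_deviation:
  assumes "(\<Sum>s\<in>S. p s) = 1" and "dual_feasible S p \<omega>" and "z = (\<Sum>s\<in>S. p s *\<^sub>R x s)"
  shows "dual_feasible S p (\<lambda>s. \<omega> s + \<beta> *\<^sub>R (x s - z))"
proof -
  have "(\<Sum>s\<in>S. p s *\<^sub>R (\<omega> s + \<beta> *\<^sub>R (x s - z))) =
      (\<Sum>s\<in>S. p s *\<^sub>R \<omega> s) + \<beta> *\<^sub>R ((\<Sum>s\<in>S. p s *\<^sub>R x s) - (\<Sum>s\<in>S. p s) *\<^sub>R z)"
    by (simp add: algebra_simps sum.distrib sum_subtractf scaleR_sum_left scaleR_sum_right)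
  then show ?thesis
    using assms unfolding dual_feasible_def by simp
qed

lemma dual_feasible_cong:
  assumes "\<And>s. s \<in> S \<Longrightarrow> \<omega> s = \<omega>' s"
  shows "dual_feasible S p \<omega> \<longleftrightarrow> dual_feasible S p \<omega>'"
  using assms unfolding dual_feasible_def by simp

theorem proposition2:
  fixes S :: "'s set"
    and p :: "'s \<Rightarrow> real"
    and c :: "real ^ 'nx"
    and q :: "'s \<Rightarrow> real ^ 'ny"
    and X :: "(real ^ 'nx) set"
    and Y :: "'s \<Rightarrow> (real ^ 'ny) set"
    and m :: "'s \<Rightarrow> nat"
    and T :: "'s \<Rightarrow> nat \<Rightarrow> real ^ 'nx"
    and W :: "'s \<Rightarrow> nat \<Rightarrow> real ^ 'ny"
    and h :: "'s \<Rightarrow> nat \<Rightarrow> real"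
    and K :: "'s \<Rightarrow> ((real ^ 'nx) \<times> (real ^ 'ny)) set"
    and \<rho> \<alpha> \<epsilon> :: real
    and kmax tmax N :: nat
    and x :: "nat \<Rightarrow> 's \<Rightarrow> real ^ 'nx"
    and y :: "nat \<Rightarrow> 's \<Rightarrow> real ^ 'ny"
    and V :: "nat \<Rightarrow> 's \<Rightarrow> ((real ^ 'nx) \<times> (real ^ 'ny)) set"
    and \<omega> :: "nat \<Rightarrow> 's \<Rightarrow> real ^ 'nx"
    and z :: "nat \<Rightarrow> real ^ 'nx"
    and \<phi>s :: "nat \<Rightarrow> 's \<Rightarrow> real"
    and \<phi> :: "nat \<Rightarrow> real"
  assumes "finite S"
    and "\<And>s. s \<in> S \<Longrightarrow> p s > 0"
    and "(\<Sum>s\<in>S. p s) = 1"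
    and "mixed_integer_linear_set X"
    and "\<And>s. s \<in> S \<Longrightarrow> mixed_integer_linear_set (Y s)"
    and "\<And>s. s \<in> S \<Longrightarrow> K s = scenario_set X (Y s) (m s) (T s) (W s) (h s)"
    and "\<And>s. s \<in> S \<Longrightarrow> K s \<noteq> {}"
    and "\<And>s. s \<in> S \<Longrightarrow> bounded (convex hull (K s))"
    and "\<rho> > 0" and "\<epsilon> \<ge> 0" and "kmax \<ge> 1" and "tmax \<ge> 1"
    and "\<And>s. s \<in> S \<Longrightarrow> finite (V 0 s) \<and> V 0 s \<subseteq> convex hull (K s)"
    and "fwph_run S p c q K \<rho> \<alpha> \<epsilon> kmax tmax N x y V \<omega> z \<phi>s \<phi>"
    and "(\<Sum>s\<in>S. p s *\<^sub>R \<omega> 0 s) = 0"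
  shows "\<forall>k\<in>{1..N}.
    (\<exists>\<omega>'. dual_feasible S p \<omega>' \<and> ereal (\<phi> k) = lagrangian_dual S p c q K \<omega>') \<and>
    ereal (\<phi> k) \<le> zeta_LD S p c q K"
proof
  fix k assume k: "k \<in> {1..N}"
  define stop where
    "stop j \<longleftrightarrow> sqrt (\<Sum>s\<in>S. p s * (norm (x j s - z (j - 1)))\<^sup>2) < \<epsilon>" for j
  note run = assms(14)[unfolded fwph_run_def Let_def, folded stop_def]
  have initial_mean: "z 0 = (\<Sum>s\<in>S. p s *\<^sub>R x 0 s)"
    using run by (elim conjE)
  have initial_update: "\<forall>s\<in>S. \<omega> 1 s = \<omega> 0 s + \<rho> *\<^sub>R (x 0 s - z 0)"
    using run by (elim conjE)
  have not_stop: "\<forall>j\<in>{1..<N}. \<not> stop j"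
    using run by (elim conjE)
  have iteration: "\<forall>j\<in>{1..N}.
      (\<forall>s\<in>S. sdm \<rho> c (q s) (K s)
         (V (j - 1) s) ((1 - \<alpha>) *\<^sub>R z (j - 1) + \<alpha> *\<^sub>R x (j - 1) s) (y (j - 1) s)
         (\<omega> j s) (z (j - 1)) tmax 0 (x j s) (y j s) (V j s) (\<phi>s j s)) \<and>
      \<phi> j = (\<Sum>s\<in>S. p s * \<phi>s j s) \<and>
      z j = (\<Sum>s\<in>S. p s *\<^sub>R x j s) \<and>
      (\<not> stop j \<longrightarrow> (\<forall>s\<in>S. \<omega> (j + 1) s = \<omega> j s + \<rho> *\<^sub>R (x j s - z j)))"
    using run by (elim conjE)
  have mean: "z j = (\<Sum>s\<in>S. p s *\<^sub>R x j s)" if "j \<le> N" for j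
    using initial_mean bspec[OF iteration, of j] that by (cases "j = 0") simp_all
  \<comment> \<open>Only the last pass can meet the stopping test, so every later multiplier that is used
    comes from an update. The initial step from \<open>\<omega> 0\<close> to \<open>\<omega> 1\<close> has the same form.\<close>
  have update: "\<forall>s\<in>S. \<omega> (Suc j) s = \<omega> j s + \<rho> *\<^sub>R (x j s - z j)" if "j < N" for j
  proof (cases "j = 0")
    case True
    then show ?thesis using initial_update by simp
  next
    case False
    with that have "j \<in> {1..<N}" "j \<in> {1..N}" by auto
    then show ?thesis
      using bspec[OF iteration, of j] bspec[OF not_stop, of j] by simp
  qed
  have feasible: "dual_feasible S p (\<omega> j)" if "j \<le> N" for j
    using that
  proof (induction j)
    case 0
    show ?case using assms(15) by (simp add: dual_feasible_def)
  next
    case (Suc j)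
    have "dual_feasible S p (\<lambda>s. \<omega> j s + \<rho> *\<^sub>R (x j s - z j))"
      using Suc by (intro dual_feasible_add_deviation[OF assms(3) _ mean]) simp_all
    moreover have "\<omega> (Suc j) s = \<omega> j s + \<rho> *\<^sub>R (x j s - z j)" if "s \<in> S" for s
      using update Suc.prems that by simp
    ultimately show ?case
      by (subst dual_feasible_cong)
  qed

  define \<omega>' where "\<omega>' = (\<lambda>s. \<omega> k s + (\<rho> * \<alpha>) *\<^sub>R (x (k - 1) s - z (k - 1)))"
  have \<omega>'_feasible: "dual_feasible S p \<omega>'"
    unfolding \<omega>'_def using k by (intro dual_feasible_add_deviation[OF assms(3) feasible mean]) auto
  have \<phi>s_eq: "ereal (\<phi>s k s) = scenario_dual c (q s) (K s) (\<omega>' s)" if s: "s \<in> S" for s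
  proof -
    have "compact (K s)"
      unfolding compact_eq_bounded_closed
    proof
      show "bounded (K s)"
        by (rule bounded_subset[OF assms(8)[OF s] hull_subset])
      show "closed (K s)"
        unfolding assms(6)[OF s]
        using assms(4) assms(5)[OF s]
        by (intro closed_scenario_set closed_mixed_integer_linear_set)
    qed
    moreover have "sdm \<rho> c (q s) (K s)
        (V (k - 1) s) ((1 - \<alpha>) *\<^sub>R z (k - 1) + \<alpha> *\<^sub>R x (k - 1) s) (y (k - 1) s)
        (\<omega> k s) (z (k - 1)) tmax 0 (x k s) (y k s) (V k s) (\<phi>s k s)"
      by (rule bspec[OF conjunct1[OF bspec[OF iteration k]] s])
    ultimately have "ereal (\<phi>s k s) = scenario_dual c (q s) (K s)
        (\<omega> k s + \<rho> *\<^sub>R (((1 - \<alpha>) *\<^sub>R z (k - 1) + \<alpha> *\<^sub>R x (k - 1) s) - z (k - 1)))"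
      by (rule sdm_value_eq_scenario_dual)
    then show ?thesis
      by (simp add: \<omega>'_def algebra_simps)
  qed
  have "ereal (\<phi> k) = lagrangian_dual S p c q K \<omega>'"
    using bspec[OF iteration k] by (simp add: lagrangian_dual_def \<phi>s_eq[symmetric] flip: sum_ereal)
  moreover from this have "ereal (\<phi> k) \<le> zeta_LD S p c q K"
    unfolding zeta_LD_def using \<omega>'_feasible by (simp add: SUP_upper)
  ultimately show "(\<exists>\<omega>'. dual_feasible S p \<omega>' \<and> ereal (\<phi> k) = lagrangian_dual S p c q K \<omega>') \<and>
      ereal (\<phi> k) \<le> zeta_LD S p c q K"
    using \<omega>'_feasible by blast
qed

end
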